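(* Let $G$ be a 2-connected series-parallel graph and $s,t$ distinct non-adjacent vertices of $G$. Any two $st$-separators $A,B$ of $G$ with $|A|=|B|$ can be reconfigured into each other under TJ.
   Context: A 2-connected graph $G$ is series-parallel if it is the simplification (keep one edge of each set of parallel edges) of a multigraph obtained from a single edge by repeatedly applying the series operation (subdivide an edge) and the parallel operation (replace an edge by two parallel copies of it). An $st$-separator is $S\subseteq V(G)\setminus\{s,t\}$ with $s,t$ in different components of $G-S$. Under TJ, separators $S,S'$ are adjacent if $|S|=|S'|$ and $|S\setminus S'|=|S'\setminus S|=1$; $A$ can be reconfigured into $B$ if there is a sequence of $st$-separators from $A$ to $B$ with consecutive sets adjacent. *)

theory Defs
  imports "HOL-Library.Multiset" "Graph_Theory.Digraph_Component"
begin

text \<open>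
  Finite simple graphs are represented by the locale predicate \<^const>\<open>graph\<close>: finite symmetric
  digraphs without loops and without parallel arcs, in which an undirected edge is a pair of
  opposite arcs. For such digraphs the strongly connected components are the components of the
  undirected graph.
\<close>

abbreviation delete_verts :: "('a, 'b) pre_digraph \<Rightarrow> 'a set \<Rightarrow> ('a, 'b) pre_digraph" where
  "delete_verts G S \<equiv> induce_subgraph G (verts G - S)"

definition vertex_connected :: "nat \<Rightarrow> ('a, 'b) pre_digraph \<Rightarrow> bool" where
  "vertex_connected k G \<longleftrightarrow>
     card (verts G) > k \<and>
     (\<forall>X \<subseteq> verts G. card X < k \<longrightarrow> connected (delete_verts G X))"

text \<open>
  An undirected multigraph is given by its vertex set and the multiset of its edges, an edge being
  the set of its two ends. Vertices are never removed by the two operations, so drawing the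
  subdivision vertices from the vertex type of the final graph loses no generality.
\<close>

inductive series_parallel_multigraph :: "'a set \<Rightarrow> 'a set multiset \<Rightarrow> bool" where
  single_edge: "u \<noteq> v \<Longrightarrow> series_parallel_multigraph {u, v} {#{u, v}#}"
| series: "\<lbrakk>series_parallel_multigraph V M; {u, v} \<in># M; w \<notin> V\<rbrakk> \<Longrightarrow>
    series_parallel_multigraph (insert w V) (M - {#{u, v}#} + {#{u, w}, {w, v}#})"
| parallel: "\<lbrakk>series_parallel_multigraph V M; e \<in># M\<rbrakk> \<Longrightarrow>
    series_parallel_multigraph V (add_mset e M)"

definition is_simplification :: "('a, 'b) pre_digraph \<Rightarrow> 'a set \<Rightarrow> 'a set multiset \<Rightarrow> bool" where
  "is_simplification G V M \<longleftrightarrow> verts G = V \<and> arcs_ends G = {(u, v). {u, v} \<in># M}"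

definition series_parallel :: "('a, 'b) pre_digraph \<Rightarrow> bool" where
  "series_parallel G \<longleftrightarrow>
     (\<exists>V M. series_parallel_multigraph V M \<and> is_simplification G V M)"

definition separator :: "('a, 'b) pre_digraph \<Rightarrow> 'a \<Rightarrow> 'a \<Rightarrow> 'a set \<Rightarrow> bool" where
  "separator G s t S \<longleftrightarrow>
     S \<subseteq> verts G - {s, t} \<and>
     (\<exists>C \<in> pre_digraph.sccs_verts (delete_verts G S).
      \<exists>D \<in> pre_digraph.sccs_verts (delete_verts G S). s \<in> C \<and> t \<in> D \<and> C \<noteq> D)"

definition tj_adjacent :: "'a set \<Rightarrow> 'a set \<Rightarrow> bool" where
  "tj_adjacent S S' \<longleftrightarrow> card S = card S' \<and> card (S - S') = 1 \<and> card (S' - S) = 1"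

definition tj_reconfigurable ::
    "('a, 'b) pre_digraph \<Rightarrow> 'a \<Rightarrow> 'a \<Rightarrow> 'a set \<Rightarrow> 'a set \<Rightarrow> bool" where
  "tj_reconfigurable G s t A B \<longleftrightarrow>
     (\<exists>Ss. Ss \<noteq> [] \<and> hd Ss = A \<and> last Ss = B \<and>
        (\<forall>S \<in> set Ss. separator G s t S) \<and> successively tj_adjacent Ss)"

end

theory Submission
  imports Defs
begin

text \<open>
  A series-parallel multigraph is a two-terminal network built from edges by series and parallel
  composition; without a cut vertex its outermost composition is parallel, and such a network can
  be re-rooted so that either \<open>s\<close>, \<open>t\<close> are its terminals, or \<open>s\<close> and \<open>t\<close> lie inside two
  networks glued in parallel at a pair \<open>p\<close>, \<open>q\<close>. In both cases there is a separator \<open>X\<close> such that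
  every separator can be moved to a superset of \<open>X\<close>, after which the remaining tokens are free.
  If \<open>s\<close>, \<open>t\<close> are the terminals, \<open>X\<close> takes one cut vertex of each parallel branch. Otherwise
  \<open>X = {p, q}\<close>: a set that shields \<open>s\<close> from \<open>p\<close> and \<open>q\<close> inside its network is pushed outwards
  through the nested compositions until it contains both.
\<close>

section \<open>Paths avoiding a vertex set\<close>

definition linked :: "'a set multiset \<Rightarrow> 'a set \<Rightarrow> 'a \<Rightarrow> 'a \<Rightarrow> bool" where
  "linked M A = (\<lambda>x y. {x, y} \<in># M \<and> x \<notin> A \<and> y \<notin> A)\<^sup>*\<^sup>*"

lemma linked_refl [simp]: "linked M A x x"
  by (simp add: linked_def)

lemma linked_edge: "{x, y} \<in># M \<Longrightarrow> x \<notin> A \<Longrightarrow> y \<notin> A \<Longrightarrow> linked M A x y"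
  by (auto simp: linked_def)

lemma linked_trans: "linked M A x y \<Longrightarrow> linked M A y z \<Longrightarrow> linked M A x z"
  by (auto simp: linked_def)

lemma linked_induct [consumes 1, case_names base step]:
  assumes "linked M A x y" and "Q x"
    and "\<And>y z. linked M A x y \<Longrightarrow> {y, z} \<in># M \<Longrightarrow> y \<notin> A \<Longrightarrow> z \<notin> A \<Longrightarrow> Q y \<Longrightarrow> Q z"
  shows "Q y"
  using assms(1) unfolding linked_def
  by (induction rule: rtranclp_induct) (use assms in \<open>auto simp: linked_def\<close>)

lemma linked_sym: "linked M A x y \<Longrightarrow> linked M A y x"
proof (induction rule: linked_induct)
  case (step y z)
  then have "linked M A z y" by (intro linked_edge) (simp_all add: insert_commute)
  then show ?case using step.IH by (rule linked_trans)
qed simp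

lemma linked_mono:
  assumes "linked M A x y" and "M \<subseteq># M'"
  shows "linked M' A x y"
  using assms(1) by (induction rule: linked_induct)
    (use assms(2) in \<open>auto intro: linked_trans linked_edge dest: mset_subset_eqD\<close>)

lemma linked_addI1: "linked M1 A x y \<Longrightarrow> linked (M1 + M2) A x y"
  and linked_addI2: "linked M2 A x y \<Longrightarrow> linked (M1 + M2) A x y"
  by (auto elim: linked_mono)

definition multigraph :: "'a set \<Rightarrow> 'a set multiset \<Rightarrow> bool" where
  "multigraph V M \<longleftrightarrow> (\<forall>e \<in># M. e \<subseteq> V)"

lemma multigraph_edge_in_verts:
  assumes "multigraph V M" and "{x, y} \<in># M"
  shows "x \<in> V" and "y \<in> V"
  using assms by (auto simp: multigraph_def)

lemma linked_antimono:
  assumes "multigraph V M" and "linked M B x y" and "A \<inter> V \<subseteq> B"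
  shows "linked M A x y"
  using assms(2)
proof (induction rule: linked_induct)
  case (step y z)
  then have "linked M A y z"
    using assms(3) multigraph_edge_in_verts[OF assms(1)] by (blast intro: linked_edge)
  with step.IH show ?case by (rule linked_trans)
qed simp

lemma linked_in_verts:
  assumes "multigraph V M" and "linked M A x y" and "x \<noteq> y"
  shows "x \<in> V - A" and "y \<in> V - A"
proof -
  have target: "v = u \<or> v \<in> V - A" if "linked M A u v" for u v
    using that multigraph_edge_in_verts[OF assms(1)] by (induction rule: linked_induct) auto
  show "y \<in> V - A" using target[OF assms(2)] assms(3) by simp
  show "x \<in> V - A" using target[OF linked_sym[OF assms(2)]] assms(3) by simp
qed

definition isolates :: "'a set multiset \<Rightarrow> 'a set \<Rightarrow> 'a \<Rightarrow> 'a set \<Rightarrow> bool" where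
  "isolates M A s T \<longleftrightarrow> (\<forall>x \<in> T - A. \<not> linked M A s x)"

lemma isolates_empty [simp]: "isolates M A s {}"
  by (simp add: isolates_def)

lemma isolates_insert:
  "isolates M A s (insert x T) \<longleftrightarrow> (x \<in> A \<or> \<not> linked M A s x) \<and> isolates M A s T"
  by (auto simp: isolates_def)

lemma isolates_addD1: "isolates (M1 + M2) A s T \<Longrightarrow> isolates M1 A s T"
  by (auto simp: isolates_def dest: linked_addI1)

lemma isolates_mono:
  assumes "multigraph V M" and "isolates M A s T" and "A \<inter> V \<subseteq> B" and "T \<inter> A \<subseteq> B"
  shows "isolates M B s T"
  using assms linked_antimono[of V M B s _ A] unfolding isolates_def by blast

lemma isolates_outside:
  assumes "multigraph V M" and "s \<notin> T" and "T \<inter> V = {}"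
  shows "isolates M A s T"
  using assms linked_in_verts(2)[of V M A s] unfolding isolates_def by blast

locale glued =
  fixes V1 :: "'a set" and M1 :: "'a set multiset" and V2 :: "'a set" and M2 :: "'a set multiset"
  assumes multigraph1: "multigraph V1 M1" and multigraph2: "multigraph V2 M2"
begin

lemma linked_add_iff:
  assumes "isolates M1 A x (V1 \<inter> V2 - {x})" and "isolates M2 A x (V1 \<inter> V2 - {x})"
  shows "linked (M1 + M2) A x y \<longleftrightarrow> linked M1 A x y \<or> linked M2 A x y"
proof
  assume "linked (M1 + M2) A x y"
  then show "linked M1 A x y \<or> linked M2 A x y"
  proof (induction rule: linked_induct)
    case (step y z)
    consider (first) "{y, z} \<in># M1" | (second) "{y, z} \<in># M2" using step.hyps by auto
    then show ?case
    proof cases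
      case first
      then have "y \<in> V1" by (rule multigraph_edge_in_verts[OF multigraph1])
      then have "linked M1 A x y"
        using step.IH step.hyps assms(2) linked_in_verts(2)[OF multigraph2]
        unfolding isolates_def by (cases "x = y") auto
      then show ?thesis using first step.hyps by (blast intro: linked_trans linked_edge)
    next
      case second
      then have "y \<in> V2" by (rule multigraph_edge_in_verts[OF multigraph2])
      then have "linked M2 A x y"
        using step.IH step.hyps assms(1) linked_in_verts(2)[OF multigraph1]
        unfolding isolates_def by (cases "x = y") auto
      then show ?thesis using second step.hyps by (blast intro: linked_trans linked_edge)
    qed
  qed simp
qed (auto intro: linked_addI1 linked_addI2)

lemma linked_add_iff_first:
  assumes "s \<in> V1" and "isolates M1 A s (V1 \<inter> V2)"
  shows "linked (M1 + M2) A s x \<longleftrightarrow> linked M1 A s x"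
proof -
  have "s \<notin> V2 - A" using assms linked_refl[of M1 A s] unfolding isolates_def by blast
  then have stuck: "x = s" if "linked M2 A s x" for x
    using linked_in_verts(1)[OF multigraph2 that] by blast
  then have "isolates M2 A s (V1 \<inter> V2 - {s})" by (auto simp: isolates_def)
  moreover have "isolates M1 A s (V1 \<inter> V2 - {s})" using assms(2) by (simp add: isolates_def)
  ultimately show ?thesis using linked_add_iff stuck by (metis linked_refl)
qed

lemma isolates_add_iff_first:
  assumes "s \<in> V1" and "isolates M1 A s (V1 \<inter> V2)"
  shows "isolates (M1 + M2) A s T \<longleftrightarrow> isolates M1 A s T"
  using linked_add_iff_first[OF assms] by (simp add: isolates_def)

end

section \<open>Two-terminal series-parallel networks\<close>

inductive sp_network :: "'a set \<Rightarrow> 'a set multiset \<Rightarrow> 'a \<Rightarrow> 'a \<Rightarrow> bool" where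
  edge: "p \<noteq> q \<Longrightarrow> sp_network {p, q} {#{p, q}#} p q"
| series: "sp_network V1 M1 p r \<Longrightarrow> sp_network V2 M2 r q \<Longrightarrow> V1 \<inter> V2 = {r} \<Longrightarrow>
    sp_network (V1 \<union> V2) (M1 + M2) p q"
| parallel: "sp_network V1 M1 p q \<Longrightarrow> sp_network V2 M2 p q \<Longrightarrow> V1 \<inter> V2 = {p, q} \<Longrightarrow>
    sp_network (V1 \<union> V2) (M1 + M2) p q"

lemma sp_network_terminals:
  assumes "sp_network V M p q"
  shows "p \<in> V" and "q \<in> V" and "p \<noteq> q"
  using assms by (induction rule: sp_network.induct) auto

lemma sp_network_sym: "sp_network V M p q \<Longrightarrow> sp_network V M q p"
proof (induction rule: sp_network.induct)
  case (edge p q)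
  then show ?case using sp_network.edge[of q p] by (simp add: insert_commute)
next
  case (series V1 M1 p r V2 M2 q)
  then show ?case using sp_network.series[of V2 M2 q r V1 M1 p] by (simp add: ac_simps)
next
  case (parallel V1 M1 p q V2 M2)
  then show ?case using sp_network.parallel[of V1 M1 q p V2 M2] by (simp add: insert_commute)
qed

lemma sp_network_edge_doubleton:
  "sp_network V M p q \<Longrightarrow> e \<in># M \<Longrightarrow> \<exists>u v. e = {u, v} \<and> u \<noteq> v \<and> u \<in> V \<and> v \<in> V"
  by (induction rule: sp_network.induct) auto

lemma sp_network_multigraph: "sp_network V M p q \<Longrightarrow> multigraph V M"
  using sp_network_edge_doubleton unfolding multigraph_def by fast

lemma sp_network_connected:
  assumes "sp_network V M p q" and "A \<inter> V = {}" and "x \<in> V" and "y \<in> V"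
  shows "linked M A x y"
  using assms
proof (induction arbitrary: x y rule: sp_network.induct)
  case (edge p q)
  then show ?case by (auto intro: linked_edge simp: insert_commute)
next
  case (series V1 M1 p r V2 M2 q)
  have "A \<inter> V1 = {}" "A \<inter> V2 = {}" "r \<in> V1" "r \<in> V2" using series by auto
  then have "linked (M1 + M2) A r z" if "z \<in> V1 \<union> V2" for z
    using that series.IH linked_addI1 linked_addI2 by (metis UnE)
  then show ?case using series.prems by (blast intro: linked_trans linked_sym)
next
  case (parallel V1 M1 p q V2 M2)
  have "A \<inter> V1 = {}" "A \<inter> V2 = {}" "p \<in> V1" "p \<in> V2" using parallel by auto
  then have "linked (M1 + M2) A p z" if "z \<in> V1 \<union> V2" for z
    using that parallel.IH linked_addI1 linked_addI2 by (metis UnE)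
  then show ?case using parallel.prems by (blast intro: linked_trans linked_sym)
qed

lemma substitute_in_union:
  assumes M: "multigraph V1 M1" "multigraph V2 M2" and edge: "{u, v} \<in># M1 + M2"
    and meet: "(V1 \<union> V2) \<inter> U = {u, v}"
    and parts: "P V1 M1" "Q V2 M2"
    and substitute1: "{u, v} \<in># M1 \<Longrightarrow> V1 \<inter> U = {u, v} \<Longrightarrow> P (V1 \<union> U) (M1 - {#{u, v}#} + N)"
    and substitute2: "{u, v} \<in># M2 \<Longrightarrow> V2 \<inter> U = {u, v} \<Longrightarrow> Q (V2 \<union> U) (M2 - {#{u, v}#} + N)"
    and compose: "\<And>W1 N1 W2 N2. P W1 N1 \<Longrightarrow> Q W2 N2 \<Longrightarrow> W1 \<inter> W2 = V1 \<inter> V2 \<Longrightarrow>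
      R (W1 \<union> W2) (N1 + N2)"
  shows "R (V1 \<union> V2 \<union> U) (M1 + M2 - {#{u, v}#} + N)"
proof (cases "{u, v} \<in># M1")
  case True
  then have "{u, v} \<subseteq> V1" using multigraph_edge_in_verts[OF M(1)] by blast
  then have "V1 \<inter> U = {u, v}" and "(V1 \<union> U) \<inter> V2 = V1 \<inter> V2" using meet by blast+
  then have "R (V1 \<union> U \<union> V2) (M1 - {#{u, v}#} + N + M2)"
    using True substitute1 parts(2) by (intro compose)
  then show ?thesis using True by (simp add: ac_simps)
next
  case False
  then have edge2: "{u, v} \<in># M2" using edge by simp
  then have "{u, v} \<subseteq> V2" using multigraph_edge_in_verts[OF M(2)] by blast
  then have "V2 \<inter> U = {u, v}" and "V1 \<inter> (V2 \<union> U) = V1 \<inter> V2" using meet by blast+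
  then have "R (V1 \<union> (V2 \<union> U)) (M1 + (M2 - {#{u, v}#} + N))"
    using edge2 substitute2 parts(1) by (intro compose)
  then show ?thesis using edge2 by (simp add: ac_simps)
qed

lemma sp_network_substitute:
  assumes "sp_network V M p q" and "{u, v} \<in># M"
    and N: "sp_network U N u v" and "V \<inter> U = {u, v}"
  shows "sp_network (V \<union> U) (M - {#{u, v}#} + N) p q"
  using assms(1,2,4)
proof (induction rule: sp_network.induct)
  case (edge p q)
  then have "{p, q} \<union> U = U" and "u = p \<and> v = q \<or> u = q \<and> v = p"
    by (auto simp: doubleton_eq_iff)
  then show ?case using edge.prems(1) N sp_network_sym[OF N] by auto
next
  case (series V1 M1 p r V2 M2 q)
  note multigraphs = series.hyps(1,2)[THEN sp_network_multigraph]
  show ?case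
    using multigraphs series.prems series.hyps(1,2) series.IH
    by (rule substitute_in_union) (simp_all add: series.hyps(3) sp_network.series)
next
  case (parallel V1 M1 p q V2 M2)
  note multigraphs = parallel.hyps(1,2)[THEN sp_network_multigraph]
  show ?case
    using multigraphs parallel.prems parallel.hyps(1,2) parallel.IH
    by (rule substitute_in_union) (simp_all add: parallel.hyps(3) sp_network.parallel)
qed

lemma series_parallel_multigraph_imp_sp_network:
  "series_parallel_multigraph V M \<Longrightarrow> \<exists>p q. sp_network V M p q"
proof (induction rule: series_parallel_multigraph.induct)
  case (single_edge u v)
  then show ?case by (blast intro: sp_network.edge)
next
  case (series V M u v w)
  then obtain p q where net: "sp_network V M p q" by blast
  have uv: "u \<noteq> v" "u \<in> V" "v \<in> V"
    using sp_network_edge_doubleton[OF net series.hyps(2)] by (auto simp: doubleton_eq_iff)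
  then have "sp_network ({u, w} \<union> {w, v}) ({#{u, w}#} + {#{w, v}#}) u v"
    using series.hyps(3) by (intro sp_network.series[where r = w] sp_network.edge) auto
  from sp_network_substitute[OF net series.hyps(2) this]
  have "sp_network (V \<union> ({u, w} \<union> {w, v})) (M - {#{u, v}#} + ({#{u, w}#} + {#{w, v}#})) p q"
    using uv series.hyps(3) by blast
  moreover have "V \<union> ({u, w} \<union> {w, v}) = insert w V" using uv by blast
  ultimately show ?case by (auto simp: add_mset_commute)
next
  case (parallel V M e)
  then obtain p q where net: "sp_network V M p q" by blast
  obtain u v where e: "e = {u, v}" and uv: "u \<noteq> v" "u \<in> V" "v \<in> V"
    using sp_network_edge_doubleton[OF net parallel.hyps(2)] by blast
  then have "sp_network ({u, v} \<union> {u, v}) ({#e#} + {#e#}) u v"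
    by (metis sp_network.parallel sp_network.edge inf.idem)
  from sp_network_substitute[OF net _ this]
  have "sp_network (V \<union> {u, v}) (M - {#e#} + {#e, e#}) p q"
    using parallel.hyps(2) e uv by auto
  then show ?case
    using parallel.hyps(2) uv by (auto simp: insert_absorb)
qed

locale series_networks =
  fixes V1 :: "'a set" and M1 :: "'a set multiset" and p r :: 'a
    and V2 :: "'a set" and M2 :: "'a set multiset" and q :: 'a
  assumes network1: "sp_network V1 M1 p r" and network2: "sp_network V2 M2 r q"
    and inter: "V1 \<inter> V2 = {r}"
begin

lemma network: "sp_network (V1 \<union> V2) (M1 + M2) p q"
  using network1 network2 inter by (rule sp_network.series)

sublocale swap: series_networks V2 M2 q r V1 M1 p
  using network1 network2 inter by unfold_locales (auto intro: sp_network_sym)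

sublocale glued V1 M1 V2 M2
  using network1 network2 by unfold_locales (blast intro: sp_network_multigraph)+

lemma terminals: "p \<in> V1 - V2" "q \<in> V2 - V1" "r \<in> V1 \<inter> V2"
  using sp_network_terminals[OF network1] sp_network_terminals[OF network2] inter
  by (metis DiffI IntI singletonD)+

lemma not_linked_through_cutvertex: "\<not> linked (M1 + M2) {r} p q"
proof -
  have "isolates M1 {r} p (V1 \<inter> V2)" by (simp add: inter isolates_def)
  then have "linked (M1 + M2) {r} p q \<longleftrightarrow> linked M1 {r} p q"
    using terminals by (intro linked_add_iff_first) auto
  then show ?thesis using linked_in_verts(2)[OF multigraph1, of "{r}" p q] terminals by blast
qed

end

locale parallel_networks =
  fixes V1 :: "'a set" and M1 :: "'a set multiset"
    and V2 :: "'a set" and M2 :: "'a set multiset" and p q :: 'a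
  assumes network1: "sp_network V1 M1 p q" and network2: "sp_network V2 M2 p q"
    and inter: "V1 \<inter> V2 = {p, q}"
begin

lemma network: "sp_network (V1 \<union> V2) (M1 + M2) p q"
  using network1 network2 inter by (rule sp_network.parallel)

sublocale swap: parallel_networks V2 M2 V1 M1 p q
  using network1 network2 inter by unfold_locales auto

sublocale glued V1 M1 V2 M2
  using network1 network2 by unfold_locales (blast intro: sp_network_multigraph)+

lemma terminals: "p \<in> V1 \<inter> V2" "q \<in> V1 \<inter> V2" "p \<noteq> q"
  using sp_network_terminals[OF network1] inter by auto

lemma flip_terminals: "parallel_networks V1 M1 V2 M2 q p"
  using network1 network2 inter by unfold_locales (auto intro: sp_network_sym)

end

section \<open>Re-rooting networks\<close>

text \<open>
  A parallel composition is a cycle of two networks; moving material of the first network into the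
  second one re-roots the decomposition until it fits the pair \<open>s\<close>, \<open>t\<close>.
\<close>

lemma rotate_series_parallel:
  assumes "series_networks Va Ma p r Vb Mb q"
    and "parallel_networks (Va \<union> Vb) (Ma + Mb) Vc Mc p q"
  shows "parallel_networks Va Ma (Vb \<union> Vc) (Mb + Mc) p r"
proof -
  interpret ab: series_networks Va Ma p r Vb Mb q by fact
  interpret abc: parallel_networks "Va \<union> Vb" "Ma + Mb" Vc Mc p q by fact
  have "Vb \<inter> Vc = Vb \<inter> {p, q}" and inter_a: "Va \<inter> Vc = Va \<inter> {p, q}" using abc.inter by blast+
  then have "Vb \<inter> Vc = {q}" using ab.terminals by simp
  with ab.network2 sp_network_sym[OF abc.network2] have "sp_network (Vb \<union> Vc) (Mb + Mc) p r"
    by (intro sp_network_sym[OF sp_network.series])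
  moreover have "Va \<inter> (Vb \<union> Vc) = {p, r}"
    unfolding Int_Un_distrib inter_a ab.inter using ab.terminals by simp
  ultimately show ?thesis using ab.network1 by unfold_locales
qed

lemma rotate_series_parallel_second:
  assumes "series_networks Va Ma p r Vb Mb q"
    and "parallel_networks (Va \<union> Vb) (Ma + Mb) Vc Mc p q"
  shows "parallel_networks Vb Mb (Va \<union> Vc) (Ma + Mc) r q"
proof -
  interpret ab: series_networks Va Ma p r Vb Mb q by fact
  interpret abc: parallel_networks "Va \<union> Vb" "Ma + Mb" Vc Mc p q by fact
  have "parallel_networks (Vb \<union> Va) (Mb + Ma) Vc Mc q p"
    using abc.flip_terminals by (simp add: ac_simps)
  with ab.swap.series_networks_axioms show ?thesis
    by (rule parallel_networks.flip_terminals[OF rotate_series_parallel])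
qed

lemma rotate_parallel_parallel:
  assumes "parallel_networks Va Ma Vb Mb p q"
    and "parallel_networks (Va \<union> Vb) (Ma + Mb) Vc Mc p q"
  shows "parallel_networks Va Ma (Vb \<union> Vc) (Mb + Mc) p q"
proof -
  interpret ab: parallel_networks Va Ma Vb Mb p q by fact
  interpret abc: parallel_networks "Va \<union> Vb" "Ma + Mb" Vc Mc p q by fact
  have "Vb \<inter> Vc = {p, q}" and "Va \<inter> (Vb \<union> Vc) = {p, q}"
    using ab.inter abc.inter by blast+
  then show ?thesis using ab.network1 ab.network2 abc.network2
    by unfold_locales (auto intro: sp_network.parallel)
qed

lemma rotate_parallel_parallel_second:
  assumes "parallel_networks Va Ma Vb Mb p q"
    and "parallel_networks (Va \<union> Vb) (Ma + Mb) Vc Mc p q"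
  shows "parallel_networks Vb Mb (Va \<union> Vc) (Ma + Mc) p q"
proof -
  interpret ab: parallel_networks Va Ma Vb Mb p q by fact
  have "parallel_networks (Vb \<union> Va) (Mb + Ma) Vc Mc p q" using assms(2) by (simp add: ac_simps)
  with ab.swap.parallel_networks_axioms show ?thesis by (rule rotate_parallel_parallel)
qed

locale split_networks = parallel_networks +
  fixes s t :: 'a
  assumes s_inner: "s \<in> V1 - {p, q}" and t_inner: "t \<in> V2 - {p, q}"
begin

sublocale swap: split_networks V2 M2 V1 M1 p q t s
  using s_inner t_inner by unfold_locales

end

definition rootable :: "'a set \<Rightarrow> 'a set multiset \<Rightarrow> 'a \<Rightarrow> 'a \<Rightarrow> bool" where
  "rootable V M s t \<longleftrightarrow> sp_network V M s t \<or>
     (\<exists>V1 M1 V2 M2 p q. split_networks V1 M1 V2 M2 p q s t \<and> V = V1 \<union> V2 \<and> M = M1 + M2)"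

lemma rootable_network: "sp_network V M s t \<Longrightarrow> rootable V M s t"
  by (simp add: rootable_def)

lemma (in split_networks) rootable: "rootable (V1 \<union> V2) (M1 + M2) s t"
  unfolding rootable_def using split_networks_axioms by blast

lemma (in parallel_networks) rootable_inner:
  "s \<in> V1 - {p, q} \<Longrightarrow> t \<in> V2 - {p, q} \<Longrightarrow> rootable (V1 \<union> V2) (M1 + M2) s t"
  by (intro split_networks.rootable[of _ _ _ _ p q]) unfold_locales

lemma rootable_sym:
  assumes "rootable V M s t"
  shows "rootable V M t s"
  using assms unfolding rootable_def
proof (elim disjE exE conjE)
  fix V1 M1 V2 M2 p q
  assume "split_networks V1 M1 V2 M2 p q s t" and eq: "V = V1 \<union> V2" "M = M1 + M2"
  then interpret split_networks V1 M1 V2 M2 p q s t by blast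
  show "sp_network V M t s \<or>
      (\<exists>V1 M1 V2 M2 p q. split_networks V1 M1 V2 M2 p q t s \<and> V = V1 \<union> V2 \<and> M = M1 + M2)"
    using swap.rootable unfolding rootable_def eq by (simp add: ac_simps)
qed (blast intro: sp_network_sym)

lemma rootable_across_series:
  assumes ab: "series_networks Va Ma p r Vb Mb q"
    and abc: "parallel_networks (Va \<union> Vb) (Ma + Mb) Vc Mc p q"
    and x: "x \<in> Va - Vb" and y: "y \<in> Vb - Va"
  shows "rootable (Va \<union> Vb \<union> Vc) (Ma + Mb + Mc) x y"
proof -
  interpret ab: series_networks Va Ma p r Vb Mb q by fact
  interpret abc: parallel_networks "Va \<union> Vb" "Ma + Mb" Vc Mc p q by fact
  interpret a: parallel_networks Va Ma "Vb \<union> Vc" "Mb + Mc" p r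
    using ab abc by (rule rotate_series_parallel)
  interpret b: parallel_networks Vb Mb "Va \<union> Vc" "Ma + Mc" r q
    using ab abc by (rule rotate_series_parallel_second)
  consider (terminals) "x = p" "y = q" | (first) "x \<noteq> p" | (second) "y \<noteq> q" by blast
  then show ?thesis
  proof cases
    case terminals
    then show ?thesis using abc.network by (simp add: rootable_network)
  next
    case first
    then have "rootable (Va \<union> (Vb \<union> Vc)) (Ma + (Mb + Mc)) x y"
      using x y ab.terminals by (intro a.rootable_inner) blast+
    then show ?thesis by (simp add: ac_simps)
  next
    case second
    then have "rootable (Vb \<union> (Va \<union> Vc)) (Mb + (Ma + Mc)) y x"
      using x y ab.terminals by (intro b.rootable_inner) blast+
    then show ?thesis using rootable_sym by (simp add: ac_simps)
  qed
qed

lemma rootable_across_parallel: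
  assumes ab: "parallel_networks Va Ma Vb Mb p q"
    and abc: "parallel_networks (Va \<union> Vb) (Ma + Mb) Vc Mc p q"
    and x: "x \<in> Va - Vb" and y: "y \<in> Vb - Va"
  shows "rootable (Va \<union> Vb \<union> Vc) (Ma + Mb + Mc) x y"
proof -
  interpret ab: parallel_networks Va Ma Vb Mb p q by fact
  interpret a: parallel_networks Va Ma "Vb \<union> Vc" "Mb + Mc" p q
    using ab abc by (rule rotate_parallel_parallel)
  have "rootable (Va \<union> (Vb \<union> Vc)) (Ma + (Mb + Mc)) x y"
    using x y ab.terminals by (intro a.rootable_inner) auto
  then show ?thesis by (simp add: ac_simps)
qed

lemma rootable_Un_cases:
  assumes "s \<in> Va \<union> Vb" and "t \<in> Va \<union> Vb"
    and "s \<in> Va \<Longrightarrow> t \<in> Va \<Longrightarrow> rootable V M s t"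
    and "s \<in> Vb \<Longrightarrow> t \<in> Vb \<Longrightarrow> rootable V M s t"
    and "\<And>x y. x \<in> Va - Vb \<Longrightarrow> y \<in> Vb - Va \<Longrightarrow> rootable V M x y"
  shows "rootable V M s t"
proof -
  consider "s \<in> Va" "t \<in> Va" | "s \<in> Vb" "t \<in> Vb"
    | "s \<in> Va - Vb" "t \<in> Vb - Va" | "s \<in> Vb - Va" "t \<in> Va - Vb"
    using assms(1,2) by blast
  then show ?thesis by cases (fact assms | rule assms(5) rootable_sym[OF assms(5)], assumption+)+
qed

lemma rootable_in_first_branch:
  assumes "sp_network V1 M1 p q" and "parallel_networks V1 M1 V2 M2 p q"
    and "s \<in> V1" and "t \<in> V1" and "s \<noteq> t"
  shows "rootable (V1 \<union> V2) (M1 + M2) s t"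
  using assms
proof (induction arbitrary: V2 M2 rule: sp_network.induct)
  case (edge p q)
  then have net: "sp_network ({p, q} \<union> V2) ({#{p, q}#} + M2) p q"
    by (intro parallel_networks.network)
  have "s = p \<and> t = q \<or> s = q \<and> t = p" using edge.prems by auto
  then show ?case using rootable_network[OF net] rootable_sym[OF rootable_network[OF net]] by auto
next
  case (series Va Ma p r Vb Mb q)
  then have ab: "series_networks Va Ma p r Vb Mb q" by (intro series_networks.intro)
  note abc = series.prems(1)
  show ?case
  proof (rule rootable_Un_cases[OF series.prems(2,3)])
    assume "s \<in> Va" and "t \<in> Va"
    then show "rootable (Va \<union> Vb \<union> V2) (Ma + Mb + M2) s t"
      using series.IH(1)[OF rotate_series_parallel[OF ab abc]] series.prems(4)
      by (simp add: ac_simps)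
  next
    assume "s \<in> Vb" and "t \<in> Vb"
    then show "rootable (Va \<union> Vb \<union> V2) (Ma + Mb + M2) s t"
      using series.IH(2)[OF rotate_series_parallel_second[OF ab abc]] series.prems(4)
      by (simp add: ac_simps)
  qed (rule rootable_across_series[OF ab abc])
next
  case (parallel Va Ma p q Vb Mb)
  then have ab: "parallel_networks Va Ma Vb Mb p q" by (intro parallel_networks.intro)
  note abc = parallel.prems(1)
  show ?case
  proof (rule rootable_Un_cases[OF parallel.prems(2,3)])
    assume "s \<in> Va" and "t \<in> Va"
    then show "rootable (Va \<union> Vb \<union> V2) (Ma + Mb + M2) s t"
      using parallel.IH(1)[OF rotate_parallel_parallel[OF ab abc]] parallel.prems(4)
      by (simp add: ac_simps)
  next
    assume "s \<in> Vb" and "t \<in> Vb"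
    then show "rootable (Va \<union> Vb \<union> V2) (Ma + Mb + M2) s t"
      using parallel.IH(2)[OF rotate_parallel_parallel_second[OF ab abc]] parallel.prems(4)
      by (simp add: ac_simps)
  qed (rule rootable_across_parallel[OF ab abc])
qed

lemma sp_network_rootable:
  assumes "sp_network V M p q" and "card V > 2"
    and no_cutvertex: "\<And>r x y. r \<in> V \<Longrightarrow> x \<in> V - {r} \<Longrightarrow> y \<in> V - {r} \<Longrightarrow> linked M {r} x y"
    and st: "s \<in> V" "t \<in> V" "s \<noteq> t"
  shows "rootable V M s t"
  using assms(1)
proof cases
  case edge
  then show ?thesis using \<open>card V > 2\<close> by simp
next
  case (series V1 M1 r V2 M2)
  then interpret series_networks V1 M1 p r V2 M2 q by unfold_locales
  have "linked M {r} p q" using terminals series(1) by (intro no_cutvertex) auto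
  then show ?thesis using not_linked_through_cutvertex series(2) by simp
next
  case (parallel V1 M1 V2 M2)
  then interpret parallel_networks V1 M1 V2 M2 p q by unfold_locales
  show ?thesis unfolding parallel(1,2)
  proof (rule rootable_Un_cases[OF st(1,2)[unfolded parallel(1)]])
    assume "s \<in> V1" and "t \<in> V1"
    with network1 parallel_networks_axioms show "rootable (V1 \<union> V2) (M1 + M2) s t"
      using st(3) by (rule rootable_in_first_branch)
  next
    assume "s \<in> V2" and "t \<in> V2"
    with network2 swap.parallel_networks_axioms have "rootable (V2 \<union> V1) (M2 + M1) s t"
      using st(3) by (rule rootable_in_first_branch)
    then show "rootable (V1 \<union> V2) (M1 + M2) s t" by (simp add: ac_simps)
  next
    show "rootable (V1 \<union> V2) (M1 + M2) x y" if "x \<in> V1 - V2" "y \<in> V2 - V1" for x y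
      using that terminals by (intro rootable_inner) auto
  qed
qed

section \<open>Token jumping\<close>

lemma tj_adjacent_iff:
  "tj_adjacent A B \<longleftrightarrow> (\<exists>a b. a \<in> A \<and> b \<notin> A \<and> B = insert b (A - {a}))"
proof
  assume "tj_adjacent A B"
  then obtain a b where "A - B = {a}" and "B - A = {b}"
    unfolding tj_adjacent_def by (meson card_1_singletonE)
  then have "a \<in> A" "b \<notin> A" "B = insert b (A - {a})" by blast+
  then show "\<exists>a b. a \<in> A \<and> b \<notin> A \<and> B = insert b (A - {a})" by blast
next
  assume "\<exists>a b. a \<in> A \<and> b \<notin> A \<and> B = insert b (A - {a})"
  then obtain a b where ab: "a \<in> A" "b \<notin> A" "B = insert b (A - {a})" by blast
  then have "A - B = {a}" and "B - A = {b}" by auto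
  moreover have "card B = card A"
    using ab(1,2) card_Suc_Diff1[of A a] unfolding ab(3) by (cases "finite A") auto
  ultimately show "tj_adjacent A B" by (simp add: tj_adjacent_def)
qed

definition tj_step :: "('a set \<Rightarrow> bool) \<Rightarrow> 'a set \<Rightarrow> 'a set \<Rightarrow> bool" where
  "tj_step P A B \<longleftrightarrow> P A \<and> P B \<and> tj_adjacent A B"

lemma tj_stepI:
  "P A \<Longrightarrow> P (insert b (A - {a})) \<Longrightarrow> a \<in> A \<Longrightarrow> b \<notin> A \<Longrightarrow> tj_step P A (insert b (A - {a}))"
  by (auto simp: tj_step_def tj_adjacent_iff)

lemma symp_tj_step: "symp (tj_step P)"
  by (auto simp: symp_def tj_step_def tj_adjacent_def)

lemma tj_steps_mono:
  assumes "(tj_step P)\<^sup>*\<^sup>* A B" and "\<And>C. P C \<Longrightarrow> Q C"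
  shows "(tj_step Q)\<^sup>*\<^sup>* A B"
  using assms(1) by (rule rtranclp_mono[THEN predicate2D, rotated])
    (use assms(2) in \<open>auto simp: tj_step_def\<close>)

lemma tj_steps_invariant: "(tj_step P)\<^sup>*\<^sup>* A B \<Longrightarrow> P A \<Longrightarrow> P B"
  by (induction rule: rtranclp_induct) (auto simp: tj_step_def)

lemma tj_steps_card: "(tj_step P)\<^sup>*\<^sup>* A B \<Longrightarrow> card B = card A"
  by (induction rule: rtranclp_induct) (auto simp: tj_step_def tj_adjacent_def)

lemma tj_steps_Un:
  assumes "(tj_step P)\<^sup>*\<^sup>* A B" and "\<And>X. P X \<Longrightarrow> X \<inter> C = {} \<and> Q (X \<union> C)"
  shows "(tj_step Q)\<^sup>*\<^sup>* (A \<union> C) (B \<union> C)"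
  using assms(1)
proof (induction rule: rtranclp_induct)
  case (step X Y)
  then obtain a b where "P X" and "P Y" and ab: "a \<in> X" "b \<notin> X" "Y = insert b (X - {a})"
    unfolding tj_step_def tj_adjacent_iff by blast
  then have disjoint: "X \<inter> C = {}" "Y \<inter> C = {}" and "Q (X \<union> C)" "Q (Y \<union> C)"
    using assms(2) by blast+
  moreover have "Y \<union> C = insert b ((X \<union> C) - {a})" "b \<notin> X \<union> C"
    using ab disjoint by blast+
  ultimately have "tj_step Q (X \<union> C) (Y \<union> C)"
    using ab(1) by (metis tj_stepI UnI1)
  with step.IH show ?case by simp
qed simp

lemma tj_steps_between_supersets:
  assumes "finite A" and "finite B" and "card A = card B" and "X \<subseteq> A" and "X \<subseteq> B"
    and "\<And>C. X \<subseteq> C \<Longrightarrow> C \<subseteq> A \<union> B \<Longrightarrow> P C"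
  shows "(tj_step P)\<^sup>*\<^sup>* A B"
  using assms
proof (induction "card (A - B)" arbitrary: A)
  case 0
  then have "A \<subseteq> B" by auto
  then have "A = B" using 0 card_subset_eq by blast
  then show ?case by simp
next
  case (Suc n)
  then obtain a where a: "a \<in> A" "a \<notin> B" by (metis Diff_iff card.empty equals0I nat.simps(3))
  have "\<not> B \<subseteq> A" using Suc.prems a card_subset_eq by metis
  then obtain b where b: "b \<in> B" "b \<notin> A" by blast
  define C where "C = insert b (A - {a})"
  have step: "tj_step P A C"
    unfolding C_def using a b Suc.prems(4,5) by (intro tj_stepI Suc.prems(6)) auto
  have "C - B = (A - B) - {a}" using b by (auto simp: C_def)
  then have "n = card (C - B)" using Suc.hyps(2) Suc.prems(1) a by simp
  then have "(tj_step P)\<^sup>*\<^sup>* C B"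
  proof (rule Suc.hyps(1))
    show "card C = card B" using step Suc.prems(3) by (simp add: tj_step_def tj_adjacent_def)
    show "P D" if "X \<subseteq> D" "D \<subseteq> C \<union> B" for D
      using that b by (intro Suc.prems(6)) (auto simp: C_def)
  qed (use Suc.prems a in \<open>auto simp: C_def\<close>)
  with step show ?case by (rule converse_rtranclp_into_rtranclp)
qed

definition tj_reaches :: "('a set \<Rightarrow> bool) \<Rightarrow> 'a set \<Rightarrow> 'a set \<Rightarrow> bool" where
  "tj_reaches P A X \<longleftrightarrow> (\<exists>B. (tj_step P)\<^sup>*\<^sup>* A B \<and> X \<subseteq> B)"

lemma tj_reaches_subset: "X \<subseteq> A \<Longrightarrow> tj_reaches P A X"
  by (auto simp: tj_reaches_def)

lemma tj_reaches_mono: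
  assumes "tj_reaches P A X" and "\<And>C. P C \<Longrightarrow> Q C"
  shows "tj_reaches Q A X"
  using assms tj_steps_mono unfolding tj_reaches_def by metis

lemma tj_reaches_trans:
  assumes "tj_reaches P A X" and "P A" and "\<And>B. P B \<Longrightarrow> X \<subseteq> B \<Longrightarrow> tj_reaches P B Y"
  shows "tj_reaches P A Y"
  using assms tj_steps_invariant unfolding tj_reaches_def by (metis rtranclp_trans)

lemma tj_reaches_insert:
  assumes "P A" and "K \<subseteq> A" and "v \<notin> A \<Longrightarrow> \<exists>a \<in> A - K. P (insert v (A - {a}))"
  shows "tj_reaches P A (insert v K)"
proof (cases "v \<in> A")
  case True
  then show ?thesis using assms(2) by (intro tj_reaches_subset) simp
next
  case False
  then obtain a where "a \<in> A - K" and "P (insert v (A - {a}))" using assms(3) by blast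
  with False have "tj_step P A (insert v (A - {a}))" and "insert v K \<subseteq> insert v (A - {a})"
    using assms(1,2) by (auto intro: tj_stepI)
  then show ?thesis unfolding tj_reaches_def by blast
qed

lemma tj_reaches_Un:
  assumes "tj_reaches P A X" and "tj_reaches Q B Y" and "P A" and "Q B"
    and join: "\<And>C D. P C \<Longrightarrow> Q D \<Longrightarrow> C \<inter> D = {} \<and> R (C \<union> D)"
  shows "tj_reaches R (A \<union> B) (X \<union> Y)"
proof -
  obtain C D where C: "(tj_step P)\<^sup>*\<^sup>* A C" "X \<subseteq> C" and D: "(tj_step Q)\<^sup>*\<^sup>* B D" "Y \<subseteq> D"
    using assms(1,2) unfolding tj_reaches_def by blast
  have "P C" using C(1) assms(3) by (rule tj_steps_invariant)
  have "(tj_step R)\<^sup>*\<^sup>* (A \<union> B) (C \<union> B)"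
    using C(1) by (rule tj_steps_Un) (rule join[OF _ assms(4)])
  moreover have "(tj_step R)\<^sup>*\<^sup>* (B \<union> C) (D \<union> C)"
    using D(1) by (rule tj_steps_Un) (use join[OF \<open>P C\<close>] in \<open>simp add: ac_simps\<close>)
  ultimately have "(tj_step R)\<^sup>*\<^sup>* (A \<union> B) (C \<union> D)"
    by (simp add: Un_commute rtranclp_trans)
  then show ?thesis using C(2) D(2) unfolding tj_reaches_def by blast
qed

definition attractor :: "('a set \<Rightarrow> bool) \<Rightarrow> 'a set \<Rightarrow> bool" where
  "attractor P X \<longleftrightarrow> P X \<and> (\<forall>A. P A \<longrightarrow> tj_reaches P A X)"

lemma tj_steps_via_attractor:
  assumes X: "attractor P X"
    and finite: "\<And>C. P C \<Longrightarrow> finite C"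
    and superset: "\<And>C D E. P C \<Longrightarrow> P D \<Longrightarrow> X \<subseteq> E \<Longrightarrow> E \<subseteq> C \<union> D \<Longrightarrow> P E"
    and AB: "P A" "P B" "card A = card B"
  shows "(tj_step P)\<^sup>*\<^sup>* A B"
proof -
  obtain A' B' where A': "(tj_step P)\<^sup>*\<^sup>* A A'" "X \<subseteq> A'" and B': "(tj_step P)\<^sup>*\<^sup>* B B'" "X \<subseteq> B'"
    using X AB unfolding attractor_def tj_reaches_def by metis
  have P: "P A'" "P B'" using tj_steps_invariant A' B' AB by blast+
  note A'(1)
  also have "(tj_step P)\<^sup>*\<^sup>* A' B'"
  proof (rule tj_steps_between_supersets)
    show "card A' = card B'" using A'(1) B'(1) AB(3) by (simp add: tj_steps_card)
    show "P C" if "X \<subseteq> C" "C \<subseteq> A' \<union> B'" for C using P that by (rule superset)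
  qed (use P finite A' B' in auto)
  also have "(tj_step P)\<^sup>*\<^sup>* B' B" using B'(1) by (rule sympD[OF symp_rtranclp[OF symp_tj_step]])
  finally show ?thesis .
qed

section \<open>Moving separators of networks\<close>

text \<open>The set \<open>W\<close> holds the positions open to tokens; tokens may also lie off the network \<open>M\<close>.\<close>

definition isolator :: "'a set \<Rightarrow> 'a set multiset \<Rightarrow> 'a \<Rightarrow> 'a set \<Rightarrow> 'a set \<Rightarrow> bool" where
  "isolator W M s T A \<longleftrightarrow> A \<subseteq> W \<and> isolates M A s T"

lemma isolator_superset_targets: "T \<subseteq> A \<Longrightarrow> A \<subseteq> W \<Longrightarrow> isolator W M s T A"
  by (auto simp: isolator_def isolates_def)

context series_networks
begin

lemma isolates_terminals_if_first:
  assumes "s \<in> V1" and "isolates M1 A s {p, r}"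
  shows "isolates (M1 + M2) A s {p, q}"
proof -
  have "isolates M1 A s {q}"
    using assms(1) terminals by (intro isolates_outside[OF multigraph1]) auto
  then have "isolates M1 A s {p, q}" and "isolates M1 A s (V1 \<inter> V2)"
    using assms(2) by (simp_all add: inter isolates_insert)
  then show ?thesis using isolates_add_iff_first[OF assms(1)] by blast
qed

lemma tj_reaches_terminals_if_isolated:
  assumes "s \<in> V1" and "{p, q} \<subseteq> W"
    and attractor: "attractor (isolator W M1 s {p, r}) {p, r}"
    and A: "isolator W M1 s {p, r} A"
  shows "tj_reaches (isolator W (M1 + M2) s {p, q}) A {p, q}"
proof -
  let ?P = "isolator W (M1 + M2) s {p, q}"
  have lift: "?P C" if "isolator W M1 s {p, r} C" for C
    using that isolates_terminals_if_first[OF assms(1)] by (simp add: isolator_def)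
  have "tj_reaches (isolator W M1 s {p, r}) A {p, r}" using attractor A by (simp add: attractor_def)
  then have "tj_reaches ?P A {p, r}" using lift by (rule tj_reaches_mono)
  from this lift[OF A] show ?thesis
  proof (rule tj_reaches_trans)
    fix B assume B: "?P B" "{p, r} \<subseteq> B"
    have "?P (insert q (B - {r}))"
      using B terminals assms(2) by (intro isolator_superset_targets) (auto simp: isolator_def)
    then have "tj_reaches ?P B (insert q {p})"
      using B terminals by (intro tj_reaches_insert) auto
    then show "tj_reaches ?P B {p, q}" by (simp add: insert_commute)
  qed
qed

lemma isolates_after_jump_to_far_terminal:
  assumes "s \<in> V1" and sr: "linked M1 A s r" "r \<notin> A"
    and A: "isolates (M1 + M2) A s {p, q}" and a: "a \<in> A \<inter> V2"
  shows "isolates (M1 + M2) (insert q (A - {a})) s {p, q}"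
proof -
  let ?C = "insert q (A - {a})"
  have "a \<notin> V1" using a sr(2) inter by (metis IntD1 IntD2 IntI singletonD)
  then have A_C: "A \<inter> V1 \<subseteq> ?C" by blast
  have "\<not> linked (M1 + M2) ?C s p" if "p \<notin> ?C"
  proof -
    have "p \<notin> A" using that \<open>a \<notin> V1\<close> terminals by auto
    then have sp: "\<not> linked M1 A s p"
      using A by (auto simp: isolates_insert dest: linked_addI1)
    have C_A: "linked M1 A x y" if "linked M1 ?C x y" for x y
      using multigraph1 that A_C by (rule linked_antimono)
    have "\<not> linked M1 ?C p r" using C_A sr(1) sp linked_sym linked_trans by metis
    then have "isolates M1 ?C p (V1 \<inter> V2)" by (simp add: inter isolates_def)
    then have "linked (M1 + M2) ?C p s \<longleftrightarrow> linked M1 ?C p s"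
      using terminals by (intro linked_add_iff_first) auto
    then show ?thesis using C_A sp linked_sym by metis
  qed
  then show ?thesis by (auto simp: isolates_insert)
qed

lemma tj_reaches_terminals_if_linked:
  assumes "s \<in> V1" and "{p, q} \<subseteq> W" and sr: "linked M1 A s r" "r \<notin> A"
    and A: "isolator W (M1 + M2) s {p, q} A"
  shows "tj_reaches (isolator W (M1 + M2) s {p, q}) A {p, q}"
proof -
  let ?P = "isolator W (M1 + M2) s {p, q}"
  have "\<exists>a \<in> A - {}. ?P (insert q (A - {a}))" if "q \<notin> A"
  proof -
    have "\<not> linked (M1 + M2) A s q" using A that by (auto simp: isolator_def isolates_insert)
    then have "\<not> linked M2 A r q" using sr(1) linked_addI1 linked_addI2 linked_trans by metis
    then obtain a where a: "a \<in> A \<inter> V2"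
      using sp_network_connected[OF network2, of A r q] terminals by blast
    have "?P (insert q (A - {a}))"
      using isolates_after_jump_to_far_terminal[OF assms(1) sr _ a] A assms(2)
      by (auto simp: isolator_def)
    then show ?thesis using a by blast
  qed
  with A have "tj_reaches ?P A {q}" by (intro tj_reaches_insert) simp_all
  from this A show ?thesis
  proof (rule tj_reaches_trans)
    fix B assume B: "?P B" "{q} \<subseteq> B"
    have "\<exists>b \<in> B - {q}. ?P (insert p (B - {b}))" if "p \<notin> B"
    proof -
      have "\<not> linked M1 B s p"
        using B(1) that by (auto simp: isolator_def isolates_insert dest: linked_addI1)
      then obtain b where b: "b \<in> B \<inter> V1"
        using sp_network_connected[OF network1, of B s p] terminals assms(1) by blast
      then have "b \<noteq> q" using terminals by blast
      then have "?P (insert p (B - {b}))"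
        using B assms(2) by (intro isolator_superset_targets) (auto simp: isolator_def)
      then show ?thesis using b \<open>b \<noteq> q\<close> by blast
    qed
    with B show "tj_reaches ?P B {p, q}" by (intro tj_reaches_insert)
  qed
qed

lemma attractor_terminals:
  assumes "s \<in> V1 - {p}" and "s \<notin> W" and "{p, q} \<subseteq> W"
    and IH: "s \<noteq> r \<Longrightarrow> attractor (isolator W M1 s {p, r}) {p, r}"
  shows "attractor (isolator W (M1 + M2) s {p, q}) {p, q}"
  unfolding attractor_def
proof (intro conjI allI impI)
  show "isolator W (M1 + M2) s {p, q} {p, q}"
    using assms(3) by (intro isolator_superset_targets) auto
  fix A assume A: "isolator W (M1 + M2) s {p, q} A"
  have "s \<in> V1" using assms(1) by simp
  show "tj_reaches (isolator W (M1 + M2) s {p, q}) A {p, q}"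
  proof (cases "linked M1 A s r \<and> r \<notin> A")
    case True
    then show ?thesis
      using tj_reaches_terminals_if_linked[OF \<open>s \<in> V1\<close> assms(3)] A by blast
  next
    case False
    then have "s \<noteq> r" using A assms(2) by (auto simp: isolator_def)
    moreover have "isolator W M1 s {p, r} A"
      using A False by (auto simp: isolator_def isolates_insert dest: linked_addI1)
    ultimately show ?thesis
      using tj_reaches_terminals_if_isolated[OF \<open>s \<in> V1\<close> assms(3) IH] by blast
  qed
qed

end

lemma (in parallel_networks) isolator_add_first:
  assumes "s \<in> V1"
  shows "isolator W (M1 + M2) s {p, q} = isolator W M1 s {p, q}"
proof
  fix A
  have "isolates (M1 + M2) A s {p, q} \<longleftrightarrow> isolates M1 A s {p, q}"
    using isolates_add_iff_first[OF assms, of A "{p, q}"] isolates_addD1 unfolding inter by metis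
  then show "isolator W (M1 + M2) s {p, q} A \<longleftrightarrow> isolator W M1 s {p, q} A"
    by (simp add: isolator_def)
qed

lemma sp_network_attractor_terminals:
  assumes "sp_network V M p q" and "s \<in> V - {p, q}" and "s \<notin> W" and "V - {s} \<subseteq> W"
  shows "attractor (isolator W M s {p, q}) {p, q}"
  using assms
proof (induction rule: sp_network.induct)
  case (edge p q)
  then show ?case by simp
next
  case (series V1 M1 p r V2 M2 q)
  then interpret series_networks V1 M1 p r V2 M2 q by (intro series_networks.intro)
  have "{p, q} \<subseteq> W" using series.prems terminals by auto
  have W: "V1 - {s} \<subseteq> W" "V2 - {s} \<subseteq> W" using series.prems(3) by blast+
  consider (first) "s \<in> V1 - {p}" | (second) "s \<in> V2 - {q}" using series.prems(1) by blast
  then show ?case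
  proof cases
    case first
    then show ?thesis
      using series.prems(2) \<open>{p, q} \<subseteq> W\<close> series.IH(1) W(1) by (intro attractor_terminals) auto
  next
    case second
    then have "attractor (isolator W (M2 + M1) s {q, p}) {q, p}"
      using series.prems(2) \<open>{p, q} \<subseteq> W\<close> series.IH(2) W(2)
      by (intro swap.attractor_terminals) (auto simp: insert_commute)
    then show ?thesis by (simp add: insert_commute add.commute)
  qed
next
  case (parallel V1 M1 p q V2 M2)
  then interpret parallel_networks V1 M1 V2 M2 p q by (intro parallel_networks.intro)
  show ?case
  proof (cases "s \<in> V1")
    case True
    then show ?thesis using parallel.IH(1) parallel.prems by (auto simp: isolator_add_first Un_Diff)
  next
    case False
    then have "attractor (isolator W (M2 + M1) s {p, q}) {p, q}"
      using parallel.IH(2) parallel.prems by (auto simp: swap.isolator_add_first Un_Diff)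
    then show ?thesis by (simp add: add.commute)
  qed
qed

definition st_cut :: "'a set \<Rightarrow> 'a set multiset \<Rightarrow> 'a \<Rightarrow> 'a \<Rightarrow> 'a set \<Rightarrow> bool" where
  "st_cut V M s t = isolator (V - {s, t}) M s {t}"

lemma st_cut_iff: "st_cut V M s t A \<longleftrightarrow> A \<subseteq> V - {s, t} \<and> \<not> linked M A s t"
  by (auto simp: st_cut_def isolator_def isolates_insert)

lemma st_cut_commute: "st_cut V M s t = st_cut V M t s"
  by (auto simp: st_cut_iff fun_eq_iff dest: linked_sym)

lemma st_cut_superset: "st_cut V M s t X \<Longrightarrow> X \<subseteq> A \<Longrightarrow> A \<subseteq> V - {s, t} \<Longrightarrow> st_cut V M s t A"
  using linked_antimono[of UNIV M A s t X] by (auto simp: st_cut_iff multigraph_def)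

lemma (in split_networks) st_cut_if_isolator:
  assumes "isolator (V1 \<union> V2 - {s, t}) M1 s {p, q} A"
  shows "st_cut (V1 \<union> V2) (M1 + M2) s t A"
proof -
  have "s \<in> V1" and "t \<notin> V1" using s_inner t_inner inter by blast+
  then have "isolates M1 A s {t}" by (intro isolates_outside[OF multigraph1]) auto
  moreover have "isolates M1 A s (V1 \<inter> V2)" using assms by (simp add: isolator_def inter)
  ultimately show ?thesis
    using assms isolates_add_iff_first[OF \<open>s \<in> V1\<close>] by (simp add: st_cut_def isolator_def)
qed

lemma (in split_networks) tj_reaches_pair_if_isolator:
  assumes "isolator (V1 \<union> V2 - {s, t}) M1 s {p, q} A"
  shows "tj_reaches (st_cut (V1 \<union> V2) (M1 + M2) s t) A {p, q}"
proof -
  have "t \<notin> V1" using t_inner inter by blast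
  then have "attractor (isolator (V1 \<union> V2 - {s, t}) M1 s {p, q}) {p, q}"
    using s_inner by (intro sp_network_attractor_terminals[OF network1]) auto
  then have "tj_reaches (isolator (V1 \<union> V2 - {s, t}) M1 s {p, q}) A {p, q}"
    using assms by (simp add: attractor_def)
  then show ?thesis using st_cut_if_isolator by (rule tj_reaches_mono)
qed

lemma (in split_networks) swap_st_cut:
  "st_cut (V2 \<union> V1) (M2 + M1) t s = st_cut (V1 \<union> V2) (M1 + M2) s t"
  by (subst st_cut_commute) (simp add: ac_simps)

lemma (in split_networks) swap_positions: "V2 \<union> V1 - {t, s} = V1 \<union> V2 - {s, t}"
  by auto

text \<open>
  If neither side of the pair isolates, one of \<open>p\<close>, \<open>q\<close> is reached from \<open>s\<close> only and the other
  from \<open>t\<close> only; a single jump to the latter makes the side of \<open>t\<close> isolating.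
\<close>

lemma (in split_networks) tj_reaches_pair_if_crossing:
  assumes A: "st_cut (V1 \<union> V2) (M1 + M2) s t A" and xy: "{p, q} = {x, y}"
    and x: "linked M1 A s x" "x \<notin> A" and y: "linked M2 A t y" "y \<notin> A"
  shows "tj_reaches (st_cut (V1 \<union> V2) (M1 + M2) s t) A {p, q}"
proof -
  let ?P = "st_cut (V1 \<union> V2) (M1 + M2) s t" and ?W = "V1 \<union> V2 - {s, t}"
  have sep: "\<not> linked (M1 + M2) A s t" and A_W: "A \<subseteq> ?W" using A by (simp_all add: st_cut_iff)
  have xy_in: "x \<in> V1 \<inter> V2" "y \<in> V1 \<inter> V2" unfolding inter xy by auto
  have "\<not> linked M1 A x y"
    using sep x(1) y(1) linked_addI1 linked_addI2 linked_sym linked_trans by metis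
  then obtain a where a: "a \<in> A" "a \<in> V1"
    using sp_network_connected[OF network1, of A x y] xy_in by blast
  have "a \<notin> V2"
  proof
    assume "a \<in> V2"
    then have "a \<in> {x, y}" using a(2) inter xy by blast
    then show False using a(1) x(2) y(2) by blast
  qed
  let ?C = "insert y (A - {a})"
  have "\<not> linked M2 A t x"
    using sep x(1) linked_addI1 linked_addI2 linked_sym linked_trans by metis
  then have "isolates M2 A t {x}" by (simp add: isolates_def)
  with multigraph2 have "isolates M2 ?C t {x}"
    by (rule isolates_mono) (use x(2) \<open>a \<notin> V2\<close> in auto)
  moreover have "y \<in> ?W" using xy_in(2) s_inner t_inner unfolding xy by auto
  ultimately have "isolator ?W M2 t {p, q} ?C"
    using A_W unfolding xy by (auto simp: isolator_def isolates_insert)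
  then have "?P ?C" and "tj_reaches ?P ?C {p, q}"
    using swap.st_cut_if_isolator swap.tj_reaches_pair_if_isolator
    unfolding swap_st_cut swap_positions by blast+
  moreover from this have "tj_step ?P A ?C" using A a y(2) by (intro tj_stepI) auto
  ultimately show ?thesis unfolding tj_reaches_def by (meson converse_rtranclp_into_rtranclp)
qed

lemma (in split_networks) attractor_pair: "attractor (st_cut (V1 \<union> V2) (M1 + M2) s t) {p, q}"
  unfolding attractor_def
proof (intro conjI allI impI)
  let ?W = "V1 \<union> V2 - {s, t}"
  have "{p, q} \<subseteq> ?W" using terminals s_inner t_inner by blast
  then show "st_cut (V1 \<union> V2) (M1 + M2) s t {p, q}"
    by (intro st_cut_if_isolator isolator_superset_targets) auto
  fix A assume A: "st_cut (V1 \<union> V2) (M1 + M2) s t A"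
  consider (first) "isolator ?W M1 s {p, q} A" | (second) "isolator ?W M2 t {p, q} A"
    | (crossing) x y where "x \<in> {p, q} - A" "linked M1 A s x" "y \<in> {p, q} - A" "linked M2 A t y"
    using A unfolding st_cut_def isolator_def isolates_def by blast
  then show "tj_reaches (st_cut (V1 \<union> V2) (M1 + M2) s t) A {p, q}"
  proof cases
    case first
    then show ?thesis by (rule tj_reaches_pair_if_isolator)
  next
    case second
    then show ?thesis
      using swap.tj_reaches_pair_if_isolator unfolding swap_st_cut swap_positions by blast
  next
    case crossing
    then have "linked (M1 + M2) A s x" "linked (M1 + M2) A y t"
      by (blast intro: linked_addI1 linked_addI2 linked_sym)+
    then have "x \<noteq> y" using A by (metis linked_trans st_cut_iff)
    then have "{p, q} = {x, y}" using crossing by auto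
    from tj_reaches_pair_if_crossing[OF A this] show ?thesis using crossing by blast
  qed
qed

lemma (in series_networks) attractor_cutvertex: "attractor (st_cut (V1 \<union> V2) (M1 + M2) p q) {r}"
  unfolding attractor_def
proof (intro conjI allI impI)
  let ?P = "st_cut (V1 \<union> V2) (M1 + M2) p q"
  show r: "?P {r}" using not_linked_through_cutvertex terminals by (auto simp: st_cut_iff)
  fix A assume A: "?P A"
  then obtain a where a: "a \<in> A"
    using sp_network_connected[OF network, of A p q] terminals by (auto simp: st_cut_iff)
  have "?P (insert r (A - {a}))"
    using r by (rule st_cut_superset) (use A r in \<open>auto simp: st_cut_iff\<close>)
  then show "tj_reaches ?P A {r}" using A a by (intro tj_reaches_insert) auto
qed

lemma (in parallel_networks) st_cut_Un:
  assumes "st_cut V1 M1 p q A" and "st_cut V2 M2 p q B"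
  shows "A \<inter> B = {}" and "st_cut (V1 \<union> V2) (M1 + M2) p q (A \<union> B)"
proof -
  have A: "A \<subseteq> V1 - {p, q}" and B: "B \<subseteq> V2 - {p, q}" using assms by (simp_all add: st_cut_iff)
  then have "A \<inter> V2 = {}" using inter by blast
  then show "A \<inter> B = {}" using B by blast
  have "V1 \<inter> V2 - {p} = {q}" using inter terminals by auto
  moreover have "isolates M1 A p {q}" and "isolates M2 B p {q}"
    using assms by (simp_all add: st_cut_def isolator_def)
  then have "isolates M1 (A \<union> B) p {q}" and "isolates M2 (A \<union> B) p {q}"
    by (auto intro: isolates_mono[OF multigraph1, of A] isolates_mono[OF multigraph2, of B])
  ultimately have "isolates (M1 + M2) (A \<union> B) p {q}"
    using linked_add_iff[of "A \<union> B" p] by (auto simp: isolates_def)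
  then show "st_cut (V1 \<union> V2) (M1 + M2) p q (A \<union> B)"
    using A B by (auto simp: st_cut_def isolator_def)
qed

lemma (in parallel_networks) st_cut_Int_first:
  assumes "st_cut (V1 \<union> V2) (M1 + M2) p q A"
  shows "st_cut V1 M1 p q (A \<inter> V1)"
  using assms linked_antimono[OF multigraph1, of "A \<inter> V1" p q A]
  by (auto simp: st_cut_iff dest: linked_addI1)

lemma (in parallel_networks) attractor_Un:
  assumes X: "attractor (st_cut V1 M1 p q) X" and Y: "attractor (st_cut V2 M2 p q) Y"
  shows "attractor (st_cut (V1 \<union> V2) (M1 + M2) p q) (X \<union> Y)"
  unfolding attractor_def
proof (intro conjI allI impI)
  let ?P = "st_cut (V1 \<union> V2) (M1 + M2) p q"
  show "?P (X \<union> Y)" using X Y st_cut_Un(2) by (simp add: attractor_def)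
  fix A assume A: "?P A"
  then have cut1: "st_cut V1 M1 p q (A \<inter> V1)" by (rule st_cut_Int_first)
  have cut2: "st_cut V2 M2 p q (A \<inter> V2)"
    using A by (intro swap.st_cut_Int_first) (simp add: ac_simps)
  have "tj_reaches ?P ((A \<inter> V1) \<union> (A \<inter> V2)) (X \<union> Y)"
  proof (rule tj_reaches_Un)
    show "tj_reaches (st_cut V1 M1 p q) (A \<inter> V1) X" "tj_reaches (st_cut V2 M2 p q) (A \<inter> V2) Y"
      using X Y cut1 cut2 by (simp_all add: attractor_def)
  qed (use cut1 cut2 st_cut_Un in auto)
  moreover have "(A \<inter> V1) \<union> (A \<inter> V2) = A" using A by (auto simp: st_cut_iff)
  ultimately show "tj_reaches ?P A (X \<union> Y)" by simp
qed

lemma sp_network_attractor_exists: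
  assumes "sp_network V M p q" and "{p, q} \<notin># M"
  shows "\<exists>X. attractor (st_cut V M p q) X"
  using assms
proof (induction rule: sp_network.induct)
  case (edge p q)
  then show ?case by simp
next
  case (series V1 M1 p r V2 M2 q)
  then interpret series_networks V1 M1 p r V2 M2 q by (intro series_networks.intro)
  show ?case using attractor_cutvertex by (rule exI)
next
  case (parallel V1 M1 p q V2 M2)
  then interpret parallel_networks V1 M1 V2 M2 p q by (intro parallel_networks.intro)
  obtain X Y where "attractor (st_cut V1 M1 p q) X" and "attractor (st_cut V2 M2 p q) Y"
    using parallel.IH parallel.prems by auto
  then show ?case by (intro exI) (rule attractor_Un)
qed

lemma rootable_attractor_exists:
  assumes "rootable V M s t" and "{s, t} \<notin># M"
  shows "\<exists>X. attractor (st_cut V M s t) X"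
  using assms(1) unfolding rootable_def
proof (elim disjE exE conjE)
  assume "sp_network V M s t"
  then show ?thesis using assms(2) by (rule sp_network_attractor_exists)
next
  fix V1 M1 V2 M2 p q
  assume "split_networks V1 M1 V2 M2 p q s t" and eq: "V = V1 \<union> V2" "M = M1 + M2"
  then show ?thesis unfolding eq by (intro exI) (rule split_networks.attractor_pair)
qed

section \<open>Separators of graphs\<close>

locale simplified_multigraph = graph G
  for G :: "('a, 'b) pre_digraph" +
  fixes V :: "'a set" and M :: "'a set multiset"
  assumes simplification: "is_simplification G V M"
begin

lemma verts_eq: "verts G = V"
  using simplification by (simp add: is_simplification_def)

lemma adj_iff: "u \<rightarrow>\<^bsub>G\<^esub> v \<longleftrightarrow> {u, v} \<in># M"
  using simplification by (simp add: is_simplification_def)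

lemma adj_delete_verts_iff:
  "u \<rightarrow>\<^bsub>delete_verts G A\<^esub> v \<longleftrightarrow> {u, v} \<in># M \<and> u \<in> V - A \<and> v \<in> V - A"
proof -
  have "u \<rightarrow>\<^bsub>delete_verts G A\<^esub> v \<longleftrightarrow> u \<rightarrow>\<^bsub>G\<^esub> v \<and> u \<in> verts G - A \<and> v \<in> verts G - A"
    by (auto simp: arcs_ends_def arc_to_ends_def)
  then show ?thesis by (simp add: adj_iff verts_eq)
qed

lemma symmetric_delete_verts: "symmetric (delete_verts G A)"
  by (auto simp: symmetric_def sym_def adj_delete_verts_iff insert_commute)

lemma reachable_delete_verts_iff:
  assumes "x \<in> V - A"
  shows "x \<rightarrow>\<^sup>*\<^bsub>delete_verts G A\<^esub> y \<longleftrightarrow> y \<in> V - A \<and> linked M A x y"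
proof -
  interpret H: wf_digraph "delete_verts G A" by (rule wellformed_induce_subgraph)
  have "y \<in> V - A \<and> linked M A x y" if "x \<rightarrow>\<^sup>*\<^bsub>delete_verts G A\<^esub> y"
    using that
  proof (induction rule: H.reachable_induct)
    case (step y z)
    then show ?case unfolding adj_delete_verts_iff by (blast intro: linked_edge linked_trans)
  qed (use assms in simp)
  moreover have "x \<rightarrow>\<^sup>*\<^bsub>delete_verts G A\<^esub> y" if "linked M A x y"
    using that
  proof (induction rule: linked_induct)
    case base
    show ?case by (rule H.reachable_refl) (use assms in \<open>simp add: verts_eq\<close>)
  next
    case (step y z)
    then have "y \<in> V" "z \<in> V" using adj_in_verts[of y z] by (simp_all add: adj_iff verts_eq)
    then have "y \<rightarrow>\<^bsub>delete_verts G A\<^esub> z" using step.hyps by (simp add: adj_delete_verts_iff)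
    with step.IH show ?case by (rule H.reachable_adj_trans)
  qed
  ultimately show ?thesis by blast
qed

lemma separator_iff_st_cut:
  assumes "s \<in> V" and "t \<in> V"
  shows "separator G s t A \<longleftrightarrow> st_cut V M s t A"
proof (cases "A \<subseteq> V - {s, t}")
  case True
  interpret H: wf_digraph "delete_verts G A" by (rule wellformed_induce_subgraph)
  have st: "s \<in> V - A" "t \<in> V - A" using assms True by auto
  have scc_of: "C = H.scc_of x" if "C \<in> H.sccs_verts" "x \<in> C" for C x
    using that H.scc_of_eq unfolding H.sccs_verts_conv_scc_of by blast
  have "separator G s t A \<longleftrightarrow> H.scc_of s \<noteq> H.scc_of t"
  proof
    assume "separator G s t A"
    then show "H.scc_of s \<noteq> H.scc_of t" using scc_of unfolding separator_def by metis
  next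
    assume "H.scc_of s \<noteq> H.scc_of t"
    then show "separator G s t A"
      using True st H.scc_of_in_sccs_verts H.in_scc_of_self
      unfolding separator_def verts_eq by (metis induce_subgraph_verts verts_eq)
  qed
  also have "\<dots> \<longleftrightarrow> \<not> s \<rightarrow>\<^sup>*\<^bsub>delete_verts G A\<^esub> t"
  proof -
    have "H.scc_of s \<noteq> H.scc_of t \<longleftrightarrow> t \<notin> H.scc_of s"
      using H.scc_of_eq H.in_scc_of_self st(2) by (metis induce_subgraph_verts verts_eq)
    then show ?thesis
      using symmetric_reachable[OF symmetric_delete_verts] by (auto simp: H.scc_of_def)
  qed
  finally show ?thesis using True st reachable_delete_verts_iff by (simp add: st_cut_iff)
next
  case False
  then show ?thesis by (simp add: separator_def verts_eq st_cut_iff)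
qed

lemma vertex_connected_imp_linked:
  assumes "vertex_connected k G" and "X \<subseteq> V" and "card X < k" and "x \<in> V - X" and "y \<in> V - X"
  shows "linked M X x y"
proof -
  interpret H: wf_digraph "delete_verts G X" by (rule wellformed_induce_subgraph)
  have "connected (delete_verts G X)"
    using assms(1-3) by (simp add: vertex_connected_def verts_eq)
  with symmetric_delete_verts have "strongly_connected (delete_verts G X)"
    by (rule H.symmetric_connected_imp_strongly_connected)
  then have "x \<rightarrow>\<^sup>*\<^bsub>delete_verts G X\<^esub> y"
    using assms(4,5) by (simp add: strongly_connected_def verts_eq)
  then show ?thesis using reachable_delete_verts_iff assms(4) by blast
qed

end

lemma tj_steps_imp_tj_reconfigurable:
  assumes "(tj_step (separator G s t))\<^sup>*\<^sup>* A B" and "separator G s t A"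
  shows "tj_reconfigurable G s t A B"
  using assms
proof (induction rule: converse_rtranclp_induct)
  case base
  then show ?case unfolding tj_reconfigurable_def by (intro exI[of _ "[B]"]) simp
next
  case (step A C)
  then obtain Ss where "Ss \<noteq> []" "hd Ss = C" "last Ss = B" "\<forall>S \<in> set Ss. separator G s t S"
      "successively tj_adjacent Ss"
    unfolding tj_step_def tj_reconfigurable_def by blast
  then show ?case
    using step.hyps(1) unfolding tj_step_def tj_reconfigurable_def
    by (intro exI[of _ "A # Ss"]) (auto simp: successively_Cons)
qed

lemma st_cut_reconfiguration:
  assumes "finite V" and "rootable V M s t" and "{s, t} \<notin># M"
    and "st_cut V M s t A" and "st_cut V M s t B" and "card A = card B"
  shows "(tj_step (st_cut V M s t))\<^sup>*\<^sup>* A B"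
proof -
  obtain X where X: "attractor (st_cut V M s t) X"
    using rootable_attractor_exists[OF assms(2,3)] by blast
  then show ?thesis
  proof (rule tj_steps_via_attractor)
    show "finite C" if "st_cut V M s t C" for C
      using that \<open>finite V\<close> by (auto simp: st_cut_iff intro: finite_subset)
    have "st_cut V M s t X" using X by (simp add: attractor_def)
    then show "st_cut V M s t E"
      if "st_cut V M s t C" "st_cut V M s t D" "X \<subseteq> E" "E \<subseteq> C \<union> D" for C D E
      by (rule st_cut_superset) (use that in \<open>auto simp: st_cut_iff\<close>)
  qed (fact assms)+
qed

theorem theorem6:
  fixes G :: "('a, 'b) pre_digraph" and s t :: 'a and A B :: "'a set"
  assumes "graph G"
    and "vertex_connected 2 G"
    and "series_parallel G"
    and "s \<in> verts G" and "t \<in> verts G" and "s \<noteq> t"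
    and "\<not> s \<rightarrow>\<^bsub>G\<^esub> t"
    and "separator G s t A" and "separator G s t B"
    and "card A = card B"
  shows "tj_reconfigurable G s t A B"
proof -
  obtain V M where sp: "series_parallel_multigraph V M" and "is_simplification G V M"
    using assms(3) unfolding series_parallel_def by blast
  then interpret simplified_multigraph G V M
    using assms(1) by (intro simplified_multigraph.intro simplified_multigraph_axioms.intro)
  have st: "s \<in> V" "t \<in> V" using assms(4,5) by (simp_all add: verts_eq)
  have sep: "separator G s t = st_cut V M s t" using separator_iff_st_cut[OF st] by blast
  obtain p q where "sp_network V M p q"
    using series_parallel_multigraph_imp_sp_network[OF sp] by blast
  then have "rootable V M s t"
  proof (rule sp_network_rootable)
    show "card V > 2" using assms(2) by (simp add: vertex_connected_def verts_eq)
    show "linked M {r} x y" if "r \<in> V" "x \<in> V - {r}" "y \<in> V - {r}" for r x y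
      using that by (intro vertex_connected_imp_linked[OF assms(2)]) auto
  qed (fact st assms(6))+
  then have "(tj_step (separator G s t))\<^sup>*\<^sup>* A B"
    using finite_verts assms(7-10) unfolding sep adj_iff verts_eq by (intro st_cut_reconfiguration)
  then show ?thesis using assms(8) by (rule tj_steps_imp_tj_reconfigurable)
qed

end
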